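(* Consider the linear stochastic Schr\"odinger equation $\mathrm{i}\,\mathrm{d}u-\Delta u\,\mathrm{d}t=\mathrm{d}W$ on $\mathbb{R}^d\times(0,\infty)$, $u(0)=u_0$, where $u_0$ is $\mathcal{F}_0$-measurable and $W$ is a $Q$-Wiener process. Let $k>0$, $t_n=nk$, and let $u^n$ be the stochastic exponential integrator defined by $u^0=u_0$ and $$u^n=S(k)u^{n-1}-\mathrm{i}S(k)\bigl(W(t_n)-W(t_{n-1})\bigr),\qquad n\ge1.$$ Let $M(u)=\int_{\mathbb{R}^d}|u|^2\,\mathrm{d}x$. Assume that $\mathbb{E}[M(u_0)]$ is finite and that $Q$ is trace-class. Then, for all $n\ge1$, $$\mathbb{E}[M(u^n)]=\mathbb{E}[M(u^{n-1})]+k\,\mathrm{Tr}(Q)=\mathbb{E}[M(u_0)]+t_n\,\mathrm{Tr}(Q).$$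
   Context: $d\ge1$ is arbitrary. $L^2=L^2(\mathbb{R}^d)$ is the space of complex-valued square integrable functions, with inner product $(u,v)=\mathrm{Re}\int_{\mathbb{R}^d}u\bar v\,\mathrm{d}x$. $S(t)=\mathrm{e}^{-\mathrm{i}t\Delta}$ is the unitary group generated by $-\mathrm{i}\Delta$. $(\Omega,\mathcal{F},\mathbb{P},\{\mathcal{F}_t\}_{t\ge0})$ is a filtered probability space with a normal filtration; $Q$ is a nonnegative self-adjoint operator on $L^2$, and $W$ is a complex-valued (i.e. $L^2$-valued), square integrable $Q$-Wiener process with respect to $\{\mathcal{F}_t\}$, so $W(t)=\sum_j\beta_j(t)Q^{1/2}e_j$ for an orthonormal basis $(e_j)$ of $L^2$ and independent standard real Brownian motions $\beta_j$. $\mathrm{Tr}(Q)=\sum_j\|Q^{1/2}e_j\|_{L^2}^2$. *)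

theory Defs
  imports "HOL-Analysis.Analysis" "HOL-Probability.Probability"
begin

section \<open>The space of complex-valued square integrable functions\<close>

definition square_integrable :: "('a::euclidean_space \<Rightarrow> complex) \<Rightarrow> bool" where
  "square_integrable f \<longleftrightarrow>
     f \<in> borel_measurable lborel \<and> integrable lborel (\<lambda>x. (cmod (f x))\<^sup>2)"

definition L2_rel :: "('a::euclidean_space \<Rightarrow> complex) \<Rightarrow> ('a \<Rightarrow> complex) \<Rightarrow> bool" where
  "L2_rel f g \<longleftrightarrow>
     square_integrable f \<and> square_integrable g \<and> (AE x in lborel. f x = g x)"

lemma square_integrable_measurable [measurable_dest]:
  "square_integrable f \<Longrightarrow> f \<in> borel_measurable lborel"
  by (simp add: square_integrable_def)

lemma square_integrable_mult_measurable:
  assumes "square_integrable f" "square_integrable g"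
  shows "(\<lambda>x. f x * cnj (g x)) \<in> borel_measurable lborel"
proof -
  have [measurable]: "f \<in> borel_measurable borel" "g \<in> borel_measurable borel"
    using assms by (auto simp: square_integrable_def)
  have "(\<lambda>x. cnj (g x)) \<in> borel_measurable borel"
    by (rule borel_measurable_continuous_on[of cnj]) (auto intro: continuous_intros)
  then show ?thesis by simp
qed

lemma square_integrable_mult:
  assumes "square_integrable f" "square_integrable g"
  shows "integrable lborel (\<lambda>x. f x * cnj (g x))"
proof (rule Bochner_Integration.integrable_bound)
  show "integrable lborel (\<lambda>x. (cmod (f x))\<^sup>2 + (cmod (g x))\<^sup>2)"
    using assms by (auto simp: square_integrable_def)
  show "(\<lambda>x. f x * cnj (g x)) \<in> borel_measurable lborel"
    using assms by (rule square_integrable_mult_measurable)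
  show "AE x in lborel. norm (f x * cnj (g x)) \<le> norm ((cmod (f x))\<^sup>2 + (cmod (g x))\<^sup>2)"
  proof (rule AE_I2)
    fix x
    have "0 \<le> (cmod (f x) - cmod (g x))\<^sup>2" "0 \<le> cmod (f x) * cmod (g x)" by auto
    then have "cmod (f x) * cmod (g x) \<le> (cmod (f x))\<^sup>2 + (cmod (g x))\<^sup>2"
      unfolding power2_diff by linarith
    then show "norm (f x * cnj (g x)) \<le> norm ((cmod (f x))\<^sup>2 + (cmod (g x))\<^sup>2)"
      by (simp add: norm_mult)
  qed
qed

lemma square_integrable_add:
  assumes "square_integrable f" "square_integrable g"
  shows "square_integrable (\<lambda>x. f x + g x)"
proof -
  have [measurable]: "f \<in> borel_measurable borel" "g \<in> borel_measurable borel"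
    using assms by (auto simp: square_integrable_def)
  have "integrable lborel (\<lambda>x. (cmod (f x + g x))\<^sup>2)"
  proof (rule Bochner_Integration.integrable_bound)
    show "integrable lborel (\<lambda>x. 2 * (cmod (f x))\<^sup>2 + 2 * (cmod (g x))\<^sup>2)"
      using assms by (auto simp: square_integrable_def)
    show "AE x in lborel. norm ((cmod (f x + g x))\<^sup>2)
            \<le> norm (2 * (cmod (f x))\<^sup>2 + 2 * (cmod (g x))\<^sup>2)"
    proof (rule AE_I2)
      fix x
      have "(cmod (f x + g x))\<^sup>2 \<le> (cmod (f x) + cmod (g x))\<^sup>2"
        by (simp add: norm_triangle_ineq power_mono)
      moreover have "0 \<le> (cmod (f x) - cmod (g x))\<^sup>2" by simp
      ultimately show "norm ((cmod (f x + g x))\<^sup>2)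
            \<le> norm (2 * (cmod (f x))\<^sup>2 + 2 * (cmod (g x))\<^sup>2)"
        by (simp add: power2_sum power2_diff)
    qed
  qed simp
  then show ?thesis by (simp add: square_integrable_def)
qed

lemma square_integrable_scale:
  "square_integrable f \<Longrightarrow> square_integrable (\<lambda>x. c * f x)"
  by (auto simp: square_integrable_def norm_mult power_mult_distrib)

lemma square_integrable_zero: "square_integrable (\<lambda>x. 0)"
  by (simp add: square_integrable_def)

text \<open>
  Every Lebesgue measurable function agrees almost everywhere with a Borel function, so the
  Borel functions on \<open>lborel\<close> yield the usual \<open>L\<^sup>2\<close>.  The inner product below is the real one,
  \<open>Re (\<integral> u cnj v)\<close>.
\<close>

quotient_type (overloaded) 'a L2 = "'a::euclidean_space \<Rightarrow> complex" / partial: L2_rel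
proof (rule part_equivpI)
  show "\<exists>f. L2_rel f f"
    by (rule exI[of _ "\<lambda>x. 0"]) (simp add: L2_rel_def square_integrable_zero)
  show "symp L2_rel"
    by (auto simp: symp_def L2_rel_def elim: AE_mp)
  show "transp L2_rel"
    unfolding transp_def L2_rel_def by (auto elim: AE_mp)
qed

instantiation L2 :: (euclidean_space) real_inner
begin

lift_definition zero_L2 :: "'a L2" is "\<lambda>x. 0"
  by (simp add: L2_rel_def square_integrable_zero)

lift_definition plus_L2 :: "'a L2 \<Rightarrow> 'a L2 \<Rightarrow> 'a L2" is "\<lambda>f g x. f x + g x"
  unfolding L2_rel_def by (auto intro: square_integrable_add elim!: AE_mp)

lift_definition uminus_L2 :: "'a L2 \<Rightarrow> 'a L2" is "\<lambda>f x. - f x"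
  unfolding L2_rel_def
  by (auto simp: square_integrable_scale[where c = "-1", simplified] elim!: AE_mp)

definition minus_L2 :: "'a L2 \<Rightarrow> 'a L2 \<Rightarrow> 'a L2" where
  "minus_L2 u v = u + - v"

lift_definition scaleR_L2 :: "real \<Rightarrow> 'a L2 \<Rightarrow> 'a L2" is "\<lambda>r f x. complex_of_real r * f x"
  unfolding L2_rel_def by (auto intro: square_integrable_scale elim!: AE_mp)

lift_definition inner_L2 :: "'a L2 \<Rightarrow> 'a L2 \<Rightarrow> real"
  is "\<lambda>f g. Re (LINT x|lborel. f x * cnj (g x))"
proof -
  fix f f' g g' :: "'a \<Rightarrow> complex"
  assume a: "L2_rel f f'" "L2_rel g g'"
  then have "(LINT x|lborel. f x * cnj (g x)) = (LINT x|lborel. f' x * cnj (g' x))"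
    unfolding L2_rel_def
    by (intro integral_cong_AE square_integrable_mult_measurable) (auto elim!: AE_mp)
  then show "Re (LINT x|lborel. f x * cnj (g x)) = Re (LINT x|lborel. f' x * cnj (g' x))"
    by simp
qed

definition norm_L2 :: "'a L2 \<Rightarrow> real" where
  "norm_L2 u = sqrt (inner u u)"

definition sgn_L2 :: "'a L2 \<Rightarrow> 'a L2" where
  "sgn_L2 u = inverse (norm u) *\<^sub>R u"

definition dist_L2 :: "'a L2 \<Rightarrow> 'a L2 \<Rightarrow> real" where
  "dist_L2 u v = norm (u - v)"

definition uniformity_L2 :: "('a L2 \<times> 'a L2) filter" where
  "uniformity_L2 = (INF e\<in>{0<..}. principal {(u, v). dist u v < e})"

definition open_L2 :: "'a L2 set \<Rightarrow> bool" where
  "open_L2 U \<longleftrightarrow> (\<forall>u\<in>U. eventually (\<lambda>(u', v). u' = u \<longrightarrow> v \<in> U) uniformity)"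

instance
proof
  fix u v w :: "'a L2" and a b r :: real
  show "u + v + w = u + (v + w)"
    by transfer (auto simp: L2_rel_def add.assoc intro: square_integrable_add)
  show "u + v = v + u"
    by transfer (auto simp: L2_rel_def add.commute intro: square_integrable_add)
  show "0 + u = u"
    by transfer (auto simp: L2_rel_def)
  show "- u + u = 0"
    by transfer (auto simp: L2_rel_def square_integrable_zero)
  show "u - v = u + - v"
    by (rule minus_L2_def)
  show "a *\<^sub>R (u + v) = a *\<^sub>R u + a *\<^sub>R v"
    by transfer (auto simp: L2_rel_def distrib_left distrib_right
        intro!: square_integrable_add square_integrable_scale)
  show "(a + b) *\<^sub>R u = a *\<^sub>R u + b *\<^sub>R u"
    by transfer (auto simp: L2_rel_def distrib_left distrib_right
        intro!: square_integrable_add square_integrable_scale)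
  show "a *\<^sub>R b *\<^sub>R u = (a * b) *\<^sub>R u"
    by transfer (auto simp: L2_rel_def mult.assoc intro!: square_integrable_scale)
  show "1 *\<^sub>R u = u"
    by transfer (auto simp: L2_rel_def)
  show "sgn u = inverse (norm u) *\<^sub>R u"
    by (rule sgn_L2_def)
  show "dist u v = norm (u - v)"
    by (rule dist_L2_def)
  show "(uniformity :: ('a L2 \<times> 'a L2) filter)
          = (INF e\<in>{0<..}. principal {(u, v). dist u v < e})"
    by (rule uniformity_L2_def)
  show "open U = (\<forall>u\<in>U. \<forall>\<^sub>F (u', v) in uniformity. u' = u \<longrightarrow> v \<in> U)" for U :: "'a L2 set"
    by (rule open_L2_def)
  show "inner u v = inner v u"
  proof (transfer)
    fix f g :: "'a \<Rightarrow> complex"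
    assume "L2_rel f f" "L2_rel g g"
    have "(LINT x|lborel. g x * cnj (f x)) = (LINT x|lborel. cnj (f x * cnj (g x)))"
      by (simp add: mult.commute)
    also have "\<dots> = cnj (LINT x|lborel. f x * cnj (g x))"
      by (rule Bochner_Integration.integral_cnj)
    finally show "Re (LINT x|lborel. f x * cnj (g x)) = Re (LINT x|lborel. g x * cnj (f x))"
      by simp
  qed
  show "inner (u + v) w = inner u w + inner v w"
    by transfer (simp add: L2_rel_def distrib_right square_integrable_mult)
  show "inner (r *\<^sub>R u) v = r * inner u v"
    by transfer (simp add: mult.assoc)
  have sq: "Re (LINT x|lborel. f x * cnj (f x)) = (LINT x|lborel. (cmod (f x))\<^sup>2)"
    for f :: "'a \<Rightarrow> complex"
    by (simp add: complex_norm_square[symmetric] del: of_real_power)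
  show "0 \<le> inner u u"
    by transfer (simp add: sq)
  show "inner u u = 0 \<longleftrightarrow> u = 0"
  proof transfer
    fix f :: "'a \<Rightarrow> complex"
    assume f: "L2_rel f f"
    then have "(LINT x|lborel. (cmod (f x))\<^sup>2) = 0 \<longleftrightarrow> (AE x in lborel. (cmod (f x))\<^sup>2 = 0)"
      by (intro integral_nonneg_eq_0_iff_AE) (auto simp: L2_rel_def square_integrable_def)
    then show "Re (LINT x|lborel. f x * cnj (f x)) = 0 \<longleftrightarrow> L2_rel f (\<lambda>x. 0)"
      using f by (auto simp: sq L2_rel_def square_integrable_zero)
  qed
  show "norm u = sqrt (inner u u)"
    by (rule norm_L2_def)
qed

end

lift_definition scaleC_L2 :: "complex \<Rightarrow> 'a::euclidean_space L2 \<Rightarrow> 'a L2"  (infixr \<open>*\<^sub>C\<close> 75)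
  is "\<lambda>c f x. c * f x"
  unfolding L2_rel_def by (auto intro: square_integrable_scale elim!: AE_mp)

lift_definition mass :: "'a::euclidean_space L2 \<Rightarrow> real"
  is "\<lambda>f. LINT x|lborel. (cmod (f x))\<^sup>2"
  unfolding L2_rel_def square_integrable_def
  by (intro integral_cong_AE) (auto elim!: AE_mp)


section \<open>The Laplacian and its unitary group\<close>

definition partial_deriv :: "'a::euclidean_space \<Rightarrow> ('a \<Rightarrow> complex) \<Rightarrow> 'a \<Rightarrow> complex" where
  "partial_deriv b f x = frechet_derivative f (at x) b"

primrec C_k :: "nat \<Rightarrow> ('a::euclidean_space \<Rightarrow> complex) \<Rightarrow> bool" where
  "C_k 0 f \<longleftrightarrow> continuous_on UNIV f"
| "C_k (Suc k) f \<longleftrightarrow> (\<forall>x. f differentiable at x) \<and> (\<forall>b\<in>Basis. C_k k (partial_deriv b f))"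

definition test_function :: "('a::euclidean_space \<Rightarrow> complex) \<Rightarrow> bool" where
  "test_function \<phi> \<longleftrightarrow> (\<forall>k. C_k k \<phi>) \<and> (\<exists>K. compact K \<and> (\<forall>x. x \<notin> K \<longrightarrow> \<phi> x = 0))"

definition laplacian :: "('a::euclidean_space \<Rightarrow> complex) \<Rightarrow> 'a \<Rightarrow> complex" where
  "laplacian \<phi> x = (\<Sum>b\<in>Basis. partial_deriv b (partial_deriv b \<phi>) x)"

lemma C_k_imp_continuous: "C_k k f \<Longrightarrow> continuous_on UNIV f"
  by (cases k)
     (auto intro!: continuous_at_imp_continuous_on differentiable_imp_continuous_within)

lemma test_function_measurable:
  assumes "test_function \<phi>"
  shows "\<phi> \<in> borel_measurable borel" "laplacian \<phi> \<in> borel_measurable borel"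
proof -
  show "\<phi> \<in> borel_measurable borel"
    using assms C_k_imp_continuous by (auto simp: test_function_def intro: borel_measurable_continuous_onI)
  have "C_k 2 \<phi>" using assms by (simp add: test_function_def)
  then have "continuous_on UNIV (\<lambda>x. laplacian \<phi> x)"
    unfolding laplacian_def
    by (intro continuous_on_sum) (auto simp: numeral_2_eq_2)
  then show "laplacian \<phi> \<in> borel_measurable borel"
    by (auto intro: borel_measurable_continuous_onI)
qed

text \<open>
  The relation \<open>weak_laplacian u v\<close> says that the distribution \<open>\<Delta>u\<close> is the square integrable
  function \<open>v\<close>.  Its domain is the Sobolev space \<open>H\<^sup>2\<close>.
\<close>

lift_definition weak_laplacian :: "'a::euclidean_space L2 \<Rightarrow> 'a L2 \<Rightarrow> bool"
  is "\<lambda>f g. \<forall>\<phi>. test_function \<phi> \<longrightarrow>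
        (LINT x|lborel. f x * laplacian \<phi> x) = (LINT x|lborel. g x * \<phi> x)"
proof -
  fix f f' g g' :: "'a \<Rightarrow> complex"
  assume a: "L2_rel f f'" "L2_rel g g'"
  have "(LINT x|lborel. f x * laplacian \<phi> x) = (LINT x|lborel. f' x * laplacian \<phi> x) \<and>
        (LINT x|lborel. g x * \<phi> x) = (LINT x|lborel. g' x * \<phi> x)"
    if "test_function \<phi>" for \<phi>
  proof -
    note [measurable] = test_function_measurable[OF that]
    have [measurable]: "f \<in> borel_measurable borel" "f' \<in> borel_measurable borel"
      "g \<in> borel_measurable borel" "g' \<in> borel_measurable borel"
      using a by (auto simp: L2_rel_def square_integrable_def)
    show ?thesis
      using a unfolding L2_rel_def by (intro conjI integral_cong_AE) (auto elim!: AE_mp)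
  qed
  then show "(\<forall>\<phi>. test_function \<phi> \<longrightarrow>
        (LINT x|lborel. f x * laplacian \<phi> x) = (LINT x|lborel. g x * \<phi> x)) =
      (\<forall>\<phi>. test_function \<phi> \<longrightarrow>
        (LINT x|lborel. f' x * laplacian \<phi> x) = (LINT x|lborel. g' x * \<phi> x))"
    by auto
qed

definition unitary_group :: "(real \<Rightarrow> 'a::euclidean_space L2 \<Rightarrow> 'a L2) \<Rightarrow> bool" where
  "unitary_group S \<longleftrightarrow>
     (\<forall>t. (\<forall>u v. S t (u + v) = S t u + S t v) \<and> (\<forall>c u. S t (c *\<^sub>C u) = c *\<^sub>C S t u) \<and>
          (\<forall>u. norm (S t u) = norm u) \<and> surj (S t)) \<and>
     (\<forall>u. S 0 u = u) \<and> (\<forall>s t u. S (s + t) u = S s (S t u)) \<and>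
     (\<forall>u. continuous_on UNIV (\<lambda>t. S t u))"

definition group_generator ::
    "(real \<Rightarrow> 'a::euclidean_space L2 \<Rightarrow> 'a L2) \<Rightarrow> 'a L2 \<Rightarrow> 'a L2 \<Rightarrow> bool" where
  "group_generator S u v \<longleftrightarrow> ((\<lambda>t. (1 / t) *\<^sub>R (S t u - u)) \<longlongrightarrow> v) (at 0)"

text \<open>
  \<open>S\<close> is the unitary group generated by \<open>-\<i>\<Delta>\<close>.  The equivalence says that the generator and
  \<open>-\<i>\<Delta>\<close> coincide as unbounded operators, domains included; by uniqueness of the group of a
  generator, this determines \<open>S\<close>.
\<close>

definition schroedinger_group :: "(real \<Rightarrow> 'a::euclidean_space L2 \<Rightarrow> 'a L2) \<Rightarrow> bool" where
  "schroedinger_group S \<longleftrightarrow> unitary_group S \<and>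
     (\<forall>u v. group_generator S u v \<longleftrightarrow> (\<exists>w. weak_laplacian u w \<and> v = (- \<i>) *\<^sub>C w))"


section \<open>Trace-class covariance operators\<close>

text \<open>
  Applied to \<open>L2\<close>, these notions refer to its real inner product; in particular orthonormal bases are bases of \<open>L2\<close> as a real Hilbert space.
\<close>

definition nonneg_selfadjoint :: "('h::real_inner \<Rightarrow> 'h) \<Rightarrow> bool" where
  "nonneg_selfadjoint A \<longleftrightarrow>
     bounded_linear A \<and> (\<forall>u v. inner (A u) v = inner u (A v)) \<and> (\<forall>u. 0 \<le> inner (A u) u)"

text \<open>\<open>is_op_sqrt R Q\<close> expresses \<open>R = Q\<^sup>1\<^sup>/\<^sup>2\<close>; the nonnegative square root is unique.\<close>

definition is_op_sqrt :: "('h::real_inner \<Rightarrow> 'h) \<Rightarrow> ('h \<Rightarrow> 'h) \<Rightarrow> bool" where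
  "is_op_sqrt R Q \<longleftrightarrow> nonneg_selfadjoint R \<and> (\<forall>u. R (R u) = Q u)"

definition orthonormal_basis :: "(nat \<Rightarrow> 'h::real_inner) \<Rightarrow> bool" where
  "orthonormal_basis e \<longleftrightarrow>
     (\<forall>i j. inner (e i) (e j) = (if i = j then 1 else 0)) \<and> closure (span (range e)) = UNIV"

text \<open>
  For nonnegative self-adjoint \<open>Q\<close> the series below has the same value (possibly infinite) for
  every orthonormal basis, so the choice of basis in the next two definitions is immaterial.
\<close>

definition has_trace :: "('h::real_inner \<Rightarrow> 'h) \<Rightarrow> real \<Rightarrow> bool" where
  "has_trace Q s \<longleftrightarrow>
     (\<exists>R e. is_op_sqrt R Q \<and> orthonormal_basis e \<and> (\<lambda>j. (norm (R (e j)))\<^sup>2) sums s)"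

definition trace_class :: "('h::real_inner \<Rightarrow> 'h) \<Rightarrow> bool" where
  "trace_class Q \<longleftrightarrow> (\<exists>s. has_trace Q s)"

definition op_trace :: "('h::real_inner \<Rightarrow> 'h) \<Rightarrow> real" where
  "op_trace Q = (THE s. has_trace Q s)"


section \<open>Filtrations and Wiener processes\<close>

definition normal_filtration :: "'w measure \<Rightarrow> (real \<Rightarrow> 'w measure) \<Rightarrow> bool" where
  "normal_filtration M F \<longleftrightarrow>
     (\<forall>t\<ge>0. subalgebra M (F t)) \<and>
     (\<forall>s\<ge>0. \<forall>t\<ge>s. sets (F s) \<subseteq> sets (F t)) \<and>
     null_sets M \<subseteq> sets (F 0) \<and>
     (\<forall>t\<ge>0. sets (F t) = (\<Inter>s\<in>{t<..}. sets (F s)))"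

definition generated_sets :: "'w measure \<Rightarrow> 'b measure \<Rightarrow> ('w \<Rightarrow> 'b) \<Rightarrow> 'w set set" where
  "generated_sets M N X = sets (vimage_algebra (space M) X N)"

definition standard_brownian_motion :: "'w measure \<Rightarrow> (real \<Rightarrow> 'w \<Rightarrow> real) \<Rightarrow> bool" where
  "standard_brownian_motion M \<beta> \<longleftrightarrow>
     (\<forall>t\<ge>0. \<beta> t \<in> borel_measurable M) \<and>
     (AE \<omega> in M. \<beta> 0 \<omega> = 0) \<and>
     (AE \<omega> in M. continuous_on {0..} (\<lambda>t. \<beta> t \<omega>)) \<and>
     (\<forall>s\<ge>0. \<forall>t>s.
        distributed M lborel (\<lambda>\<omega>. \<beta> t \<omega> - \<beta> s \<omega>) (normal_density 0 (sqrt (t - s))) \<and>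
        prob_space.indep_set M
          (generated_sets M (Pi\<^sub>M {0..s} (\<lambda>_. borel)) (\<lambda>\<omega>. \<lambda>r\<in>{0..s}. \<beta> r \<omega>))
          (generated_sets M borel (\<lambda>\<omega>. \<beta> t \<omega> - \<beta> s \<omega>)))"

text \<open>
  A square integrable \<open>Q\<close>-Wiener process with respect to the filtration \<open>F\<close>: an adapted continuous
  process whose increments are independent of the past and which has the expansion
  \<open>W t = (\<Sum>j. \<beta>\<^sub>j t Q\<^sup>1\<^sup>/\<^sup>2 e\<^sub>j)\<close>, convergent in mean square.
\<close>

definition Q_wiener_process ::
    "'w measure \<Rightarrow> (real \<Rightarrow> 'w measure) \<Rightarrow> ('h::real_inner \<Rightarrow> 'h) \<Rightarrow> (real \<Rightarrow> 'w \<Rightarrow> 'h) \<Rightarrow> bool" where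
  "Q_wiener_process M F Q W \<longleftrightarrow>
     (\<forall>t\<ge>0. W t \<in> borel_measurable (F t)) \<and>
     (AE \<omega> in M. W 0 \<omega> = 0) \<and>
     (AE \<omega> in M. continuous_on {0..} (\<lambda>t. W t \<omega>)) \<and>
     (\<forall>s\<ge>0. \<forall>t\<ge>s. prob_space.indep_set M
        (sets (F s)) (generated_sets M borel (\<lambda>\<omega>. W t \<omega> - W s \<omega>))) \<and>
     (\<exists>R e \<beta>. is_op_sqrt R Q \<and> orthonormal_basis e \<and>
        (\<forall>j. standard_brownian_motion M (\<beta> j)) \<and>
        prob_space.indep_vars M (\<lambda>j. Pi\<^sub>M {0..} (\<lambda>_. borel))
          (\<lambda>j \<omega>. \<lambda>t\<in>{0..}. \<beta> j t \<omega>) (UNIV :: nat set) \<and>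
        (\<forall>t\<ge>0. ((\<lambda>N. \<integral>\<^sup>+\<omega>. ennreal ((norm (W t \<omega> - (\<Sum>j<N. \<beta> j t \<omega> *\<^sub>R R (e j))))\<^sup>2) \<partial>M)
                  \<longlonglongrightarrow> 0)))"


section \<open>The stochastic exponential integrator\<close>

primrec exponential_integrator ::
    "(real \<Rightarrow> 'a::euclidean_space L2 \<Rightarrow> 'a L2) \<Rightarrow> real \<Rightarrow> (real \<Rightarrow> 'w \<Rightarrow> 'a L2) \<Rightarrow> ('w \<Rightarrow> 'a L2) \<Rightarrow>
     nat \<Rightarrow> 'w \<Rightarrow> 'a L2" where
  "exponential_integrator S k W u0 0 \<omega> = u0 \<omega>"
| "exponential_integrator S k W u0 (Suc n) \<omega> =
     S k (exponential_integrator S k W u0 n \<omega>)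
       - \<i> *\<^sub>C S k (W (real (Suc n) * k) \<omega> - W (real n * k) \<omega>)"

end

theory Submission
  imports Defs
begin

text \<open>
  The mass is the squared \<open>L\<^sup>2\<close> norm.  Because \<open>S k\<close> is an isometry that commutes with \<open>\<i>\<close>, one
  step of the integrator has the same mass as \<open>u - \<i> w\<close>, where \<open>u\<close> is the current iterate and \<open>w\<close>
  the increment of the noise.  Expanding the square gives \<open>\<parallel>u\<parallel>\<^sup>2 + \<parallel>w\<parallel>\<^sup>2\<close> and a cross term
  \<open>2 (\<i> u, w)\<close> (lemma \<open>exponential_integrator_step_norm\<close>).  In expectation the second term is
  \<open>k Tr Q\<close> (\<open>Q_wiener_increment\<close>) and the cross term vanishes, because \<open>u\<close> is determined by the
  past while \<open>w\<close> is centered and independent of the past (\<open>expectation_inner_independent\<close>).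
  Induction on the number of steps yields the linear growth.

  Everything is reduced to scalars: measurability and expectations are stated for the functions
  \<open>inner (X \<omega>) v\<close> and \<open>(norm (X \<omega>))\<^sup>2\<close>, and Parseval's identity, a consequence of the density of the
  span of an orthonormal basis, recovers the vectors from their coordinates.

  The value \<open>op_trace Q\<close> is defined through some square root \<open>R\<close> of \<open>Q\<close> and some orthonormal
  basis, whereas the expansion of \<open>W\<close> may involve others.  That both give the same series rests
  on \<open>\<parallel>R u\<parallel>\<^sup>2 = (Q u, u)\<close>, in which \<open>R\<close> no longer occurs, and on Parseval's identity
  (\<open>trace_class_sums\<close>).
\<close>

section \<open>Orthonormal bases and Parseval's identity\<close>

definition fourier_sum :: "(nat \<Rightarrow> 'h::real_inner) \<Rightarrow> nat \<Rightarrow> 'h \<Rightarrow> 'h" where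
  "fourier_sum e N u = (\<Sum>j<N. inner u (e j) *\<^sub>R e j)"

lemma fourier_sum_add: "fourier_sum e N (u + v) = fourier_sum e N u + fourier_sum e N v"
  by (simp add: fourier_sum_def inner_add_left scaleR_add_left sum.distrib)

lemma fourier_sum_scaleR: "fourier_sum e N (c *\<^sub>R u) = c *\<^sub>R fourier_sum e N u"
  by (simp add: fourier_sum_def scaleR_sum_right)

lemma fourier_sum_diff: "fourier_sum e N (u - v) = fourier_sum e N u - fourier_sum e N v"
  by (simp add: fourier_sum_def inner_diff_left scaleR_diff_left sum_subtractf)

lemma inner_fourier_sum_left:
  "inner (fourier_sum e N u) v = (\<Sum>j<N. inner u (e j) * inner v (e j))"
  by (simp add: fourier_sum_def inner_sum_left inner_sum_right inner_commute[of _ v])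

lemma orthonormal_basis_inner:
  "orthonormal_basis e \<Longrightarrow> inner (e i) (e j) = (if i = j then 1 else 0)"
  by (simp add: orthonormal_basis_def)

lemma inner_fourier_sum_basis:
  assumes "orthonormal_basis e" "j < N"
  shows "inner (fourier_sum e N u) (e j) = inner u (e j)"
  using assms
  by (simp add: inner_fourier_sum_left orthonormal_basis_inner if_distrib[of "(*) _"] cong: if_cong)

lemma norm_fourier_sum:
  assumes "orthonormal_basis e"
  shows "(norm (fourier_sum e N u))\<^sup>2 = (\<Sum>j<N. (inner u (e j))\<^sup>2)"
proof -
  have "(norm (fourier_sum e N u))\<^sup>2 = (\<Sum>j<N. inner u (e j) * inner (fourier_sum e N u) (e j))"
    unfolding power2_norm_eq_inner by (rule inner_fourier_sum_left)
  also have "\<dots> = (\<Sum>j<N. (inner u (e j))\<^sup>2)"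
    using assms by (simp add: inner_fourier_sum_basis power2_eq_square)
  finally show ?thesis .
qed

text \<open>
  Bessel's inequality, from \<open>\<parallel>u\<parallel>\<^sup>2 - \<parallel>P u\<parallel>\<^sup>2 = \<parallel>u - P u\<parallel>\<^sup>2\<close> for the orthogonal projection \<open>P u\<close>
  onto the span of the first \<open>N\<close> basis vectors.
\<close>
lemma norm_fourier_sum_le:
  assumes "orthonormal_basis e"
  shows "norm (fourier_sum e N u) \<le> norm u"
proof -
  have "inner u (fourier_sum e N u) = (norm (fourier_sum e N u))\<^sup>2"
    unfolding inner_commute[of u "fourier_sum e N u"] inner_fourier_sum_left norm_fourier_sum[OF assms]
    by (simp only: power2_eq_square)
  then have "(norm u)\<^sup>2 - (norm (fourier_sum e N u))\<^sup>2
      = inner (u - fourier_sum e N u) (u - fourier_sum e N u)"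
    by (simp add: inner_diff_left inner_diff_right inner_commute[of "fourier_sum e N u" u]
        power2_norm_eq_inner)
  also have "\<dots> \<ge> 0" by (rule inner_ge_zero)
  finally have "(norm (fourier_sum e N u))\<^sup>2 \<le> (norm u)\<^sup>2" by linarith
  then show ?thesis by (rule power2_le_imp_le) simp
qed

text \<open>
  The vectors whose Fourier sums converge to them form a subspace that contains the basis.  This
  subspace is closed, because the Fourier sums are uniformly Lipschitz by Bessel's inequality.
  Hence it contains the closure of the span of the basis, which is the whole space.
\<close>
lemma fourier_sum_tendsto:
  assumes e: "orthonormal_basis e"
  shows "(\<lambda>N. fourier_sum e N u) \<longlonglongrightarrow> u"
proof -
  define V where "V = {u. (\<lambda>N. fourier_sum e N u) \<longlonglongrightarrow> u}"
  have "subspace V"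
    unfolding subspace_def V_def
    by (auto simp: fourier_sum_add fourier_sum_scaleR intro: tendsto_add tendsto_scaleR)
       (simp add: fourier_sum_def)
  moreover have "range e \<subseteq> V"
  proof (clarsimp simp: V_def)
    fix i
    have "\<forall>\<^sub>F N in sequentially. fourier_sum e N (e i) = e i"
      using eventually_gt_at_top[of i]
    proof eventually_elim
      case (elim N)
      have "fourier_sum e N (e i) = (\<Sum>j<N. if i = j then e j else 0)"
        unfolding fourier_sum_def using e by (intro sum.cong) (auto simp: orthonormal_basis_inner)
      also have "\<dots> = e i" using elim by simp
      finally show ?case .
    qed
    then show "(\<lambda>N. fourier_sum e N (e i)) \<longlonglongrightarrow> e i" by (rule tendsto_eventually)
  qed
  ultimately have "span (range e) \<subseteq> V" by (rule span_minimal[rotated])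
  moreover have "closed V"
  proof (rule closed_sequential_limits[THEN iffD2], intro allI impI)
    fix x l assume "(\<forall>n. x n \<in> V) \<and> x \<longlonglongrightarrow> l"
    then have x: "\<And>n. (\<lambda>N. fourier_sum e N (x n)) \<longlonglongrightarrow> x n" and l: "x \<longlonglongrightarrow> l"
      by (auto simp: V_def)
    show "l \<in> V" unfolding V_def
    proof (clarify, rule metric_LIMSEQ_I)
      fix r :: real assume r: "0 < r"
      obtain n where n: "dist (x n) l < r/3"
        using metric_LIMSEQ_D[OF l, of "r/3"] r by auto
      obtain N0 where N0: "\<And>N. N \<ge> N0 \<Longrightarrow> dist (fourier_sum e N (x n)) (x n) < r/3"
        using metric_LIMSEQ_D[OF x[of n], of "r/3"] r by auto
      have "dist (fourier_sum e N l) l < r" if "N \<ge> N0" for N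
      proof -
        have "dist (fourier_sum e N l) (fourier_sum e N (x n)) \<le> dist l (x n)"
          using norm_fourier_sum_le[OF e, of N "l - x n"] by (simp add: dist_norm fourier_sum_diff)
        then show ?thesis
          using n N0[OF that] dist_triangle[of "fourier_sum e N l" l "fourier_sum e N (x n)"]
            dist_triangle[of "fourier_sum e N (x n)" l "x n"]
          by (simp add: dist_commute)
      qed
      then show "\<exists>N0. \<forall>N\<ge>N0. dist (fourier_sum e N l) l < r" by blast
    qed
  qed
  ultimately have "closure (span (range e)) \<subseteq> V" by (rule closure_minimal)
  then show ?thesis using e by (auto simp: V_def orthonormal_basis_def)
qed

lemma parseval_inner:
  assumes "orthonormal_basis e"
  shows "(\<lambda>j. inner u (e j) * inner v (e j)) sums inner u v"
  using tendsto_inner[OF fourier_sum_tendsto[OF assms, of u] tendsto_const[of v]]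
  by (simp add: sums_def inner_fourier_sum_left)

lemma parseval:
  assumes "orthonormal_basis e"
  shows "(\<lambda>j. (inner u (e j))\<^sup>2) sums (norm u)\<^sup>2"
  using parseval_inner[OF assms, of u u] unfolding power2_norm_eq_inner
  by (simp add: power2_eq_square)

section \<open>Independence of the trace from the basis and the square root\<close>

lemma suminf_ennreal_commute:
  fixes f :: "nat \<Rightarrow> nat \<Rightarrow> ennreal"
  shows "(\<Sum>i. \<Sum>j. f i j) = (\<Sum>j. \<Sum>i. f i j)"
  using nn_integral_suminf[of "\<lambda>j i. f i j" "count_space UNIV"]
  by (simp add: nn_integral_count_space_nat)

text \<open>
  Both sums equal the double sum of \<open>(R e\<^sub>j, f\<^sub>i)\<^sup>2 = (e\<^sub>j, R f\<^sub>i)\<^sup>2\<close>.  Working with values in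
  \<open>[0, \<infinity>]\<close> makes the interchange of the summations unconditional, so that convergence for one
  basis entails convergence for every other one.
\<close>
lemma sum_norm_basis_independent:
  assumes R: "\<And>u v. inner (R u) v = inner u (R v)"
    and e: "orthonormal_basis e" and f: "orthonormal_basis f"
  shows "(\<Sum>j. ennreal ((norm (R (e j)))\<^sup>2)) = (\<Sum>i. ennreal ((norm (R (f i)))\<^sup>2))"
proof -
  have ex: "ennreal ((norm u)\<^sup>2) = (\<Sum>i. ennreal ((inner u (b i))\<^sup>2))"
    if "orthonormal_basis b" for u and b :: "nat \<Rightarrow> 'a"
    by (rule suminf_ennreal_eq[OF _ parseval[OF that], symmetric]) simp
  have swap: "inner (R (e j)) (f i) = inner (R (f i)) (e j)" for i j
    by (metis R inner_commute)
  have "(\<Sum>j. ennreal ((norm (R (e j)))\<^sup>2)) = (\<Sum>j. \<Sum>i. ennreal ((inner (R (e j)) (f i))\<^sup>2))"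
    by (simp add: ex[OF f])
  also have "\<dots> = (\<Sum>i. \<Sum>j. ennreal ((inner (R (e j)) (f i))\<^sup>2))"
    by (rule suminf_ennreal_commute)
  also have "\<dots> = (\<Sum>i. ennreal ((norm (R (f i)))\<^sup>2))"
    by (simp add: ex[OF e] swap)
  finally show ?thesis .
qed

lemma is_op_sqrt_inner: "is_op_sqrt R Q \<Longrightarrow> inner (R u) v = inner u (R v)"
  by (simp add: is_op_sqrt_def nonneg_selfadjoint_def)

text \<open>
  As the right-hand side does not mention \<open>R\<close>, all square roots of \<open>Q\<close> give the same trace.
\<close>
lemma is_op_sqrt_norm:
  assumes "is_op_sqrt R Q"
  shows "(norm (R u))\<^sup>2 = inner (Q u) u"
  using assms is_op_sqrt_inner[OF assms, of "R u" u]
  by (simp add: power2_norm_eq_inner is_op_sqrt_def)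

lemma has_trace_sums:
  assumes tr: "has_trace Q s" and R: "is_op_sqrt R Q" and e: "orthonormal_basis e"
  shows "(\<lambda>j. (norm (R (e j)))\<^sup>2) sums s"
proof -
  from tr obtain R' f where R': "is_op_sqrt R' Q" and f: "orthonormal_basis f"
    and s: "(\<lambda>j. (norm (R' (f j)))\<^sup>2) sums s"
    by (auto simp: has_trace_def)
  have s': "(\<lambda>j. (norm (R (f j)))\<^sup>2) sums s"
    using s by (simp add: is_op_sqrt_norm[OF R'] is_op_sqrt_norm[OF R])
  have "s \<ge> 0" by (rule sums_le[OF _ sums_zero s']) simp
  have "(\<Sum>j. ennreal ((norm (R (e j)))\<^sup>2)) = ennreal s"
    unfolding sum_norm_basis_independent[OF is_op_sqrt_inner[OF R] e f]
    by (rule suminf_ennreal_eq[OF _ s']) simp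
  then have "(\<lambda>j. ennreal ((norm (R (e j)))\<^sup>2)) sums ennreal s"
    by (metis summableI summable_sums)
  then show ?thesis using \<open>s \<ge> 0\<close> by simp
qed

lemma trace_class_sums:
  assumes "trace_class Q" and R: "is_op_sqrt R Q" and e: "orthonormal_basis e"
  shows "(\<lambda>j. (norm (R (e j)))\<^sup>2) sums op_trace Q"
proof -
  from assms(1) obtain s where s: "has_trace Q s" by (auto simp: trace_class_def)
  have "op_trace Q = s"
    unfolding op_trace_def
    using s has_trace_sums[OF _ R e] by (blast intro: sums_unique2)
  then show ?thesis using has_trace_sums[OF s R e] by simp
qed

section \<open>Weak measurability\<close>

text \<open>
  This notion passes to sums because the inner product is linear.  For Borel measurability the
  same is delicate: the Borel \<open>\<sigma>\<close>-algebra of a product space can be larger than the product of the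
  Borel \<open>\<sigma>\<close>-algebras.
\<close>
definition weakly_measurable :: "'w measure \<Rightarrow> ('w \<Rightarrow> 'h::real_inner) \<Rightarrow> bool" where
  "weakly_measurable M X \<longleftrightarrow> (\<forall>v. (\<lambda>\<omega>. inner (X \<omega>) v) \<in> borel_measurable M)"

lemma weakly_measurableD [measurable_dest]:
  "weakly_measurable M X \<Longrightarrow> (\<lambda>\<omega>. inner (X \<omega>) v) \<in> borel_measurable M"
  by (simp add: weakly_measurable_def)

lemma borel_measurable_imp_weakly_measurable:
  assumes "X \<in> borel_measurable M"
  shows "weakly_measurable M X"
  unfolding weakly_measurable_def
  by (intro allI measurable_compose[OF assms] borel_measurable_continuous_onI continuous_intros)

lemma weakly_measurable_diff:
  "weakly_measurable M X \<Longrightarrow> weakly_measurable M Y \<Longrightarrow> weakly_measurable M (\<lambda>\<omega>. X \<omega> - Y \<omega>)"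
  unfolding weakly_measurable_def inner_diff_left by (intro allI borel_measurable_diff) auto

lemma weakly_measurable_sum_scaleR:
  assumes "\<And>j. c j \<in> borel_measurable M"
  shows "weakly_measurable M (\<lambda>\<omega>. \<Sum>j\<in>J. c j \<omega> *\<^sub>R a j)"
  using assms by (simp add: weakly_measurable_def inner_sum_left)

lemma weakly_measurable_subalgebra:
  "weakly_measurable G X \<Longrightarrow> subalgebra M G \<Longrightarrow> weakly_measurable M X"
  by (auto simp: weakly_measurable_def intro: measurable_from_subalg)

text \<open>
  Parseval's identity exhibits the inner product as a pointwise limit of finite sums of products
  of measurable coordinates.
\<close>
lemma weakly_measurable_inner:
  fixes X Y :: "'w \<Rightarrow> 'h::real_inner" and e :: "nat \<Rightarrow> 'h"
  assumes e: "orthonormal_basis e" and "weakly_measurable M X" "weakly_measurable M Y"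
  shows "(\<lambda>\<omega>. inner (X \<omega>) (Y \<omega>)) \<in> borel_measurable M"
proof (rule borel_measurable_LIMSEQ_real)
  show "(\<lambda>N. \<Sum>j<N. inner (X \<omega>) (e j) * inner (Y \<omega>) (e j)) \<longlonglongrightarrow> inner (X \<omega>) (Y \<omega>)" for \<omega>
    using parseval_inner[OF e] by (simp add: sums_def)
  show "(\<lambda>\<omega>. \<Sum>j<N. inner (X \<omega>) (e j) * inner (Y \<omega>) (e j)) \<in> borel_measurable M" for N
    using assms by measurable
qed

lemma weakly_measurable_norm:
  fixes X :: "'w \<Rightarrow> 'h::real_inner" and e :: "nat \<Rightarrow> 'h"
  assumes "orthonormal_basis e" and "weakly_measurable M X"
  shows "(\<lambda>\<omega>. (norm (X \<omega>))\<^sup>2) \<in> borel_measurable M"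
  using weakly_measurable_inner[OF assms(1,2,2)] by (simp add: power2_norm_eq_inner)

section \<open>Limits in mean square\<close>

text \<open>
  Passage from convergence of integrals in \<open>[0, \<infinity>]\<close> to real-valued ones.  Integrability can only be
  expected for large \<open>N\<close>, as the first integrals may be infinite.
\<close>
lemma nn_integral_tendsto_0:
  fixes D :: "nat \<Rightarrow> 'w \<Rightarrow> real"
  assumes [measurable]: "\<And>N. D N \<in> borel_measurable M"
    and nonneg: "\<And>N \<omega>. 0 \<le> D N \<omega>"
    and lim: "(\<lambda>N. \<integral>\<^sup>+\<omega>. ennreal (D N \<omega>) \<partial>M) \<longlonglongrightarrow> 0"
  shows "\<forall>\<^sub>F N in sequentially. integrable M (D N)"
    and "(\<lambda>N. \<integral>\<omega>. D N \<omega> \<partial>M) \<longlonglongrightarrow> 0"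
proof -
  have "\<forall>\<^sub>F N in sequentially. (\<integral>\<^sup>+\<omega>. ennreal (D N \<omega>) \<partial>M) < 1"
    using order_tendstoD(2)[OF lim] by simp
  then show "\<forall>\<^sub>F N in sequentially. integrable M (D N)"
  proof eventually_elim
    case (elim N)
    then show ?case
      using nonneg by (intro integrableI_nonneg) (auto simp: less_top[symmetric])
  qed
  have "(\<lambda>N. enn2real (\<integral>\<^sup>+\<omega>. ennreal (D N \<omega>) \<partial>M)) \<longlonglongrightarrow> enn2real 0"
    using lim by (intro tendsto_enn2real) auto
  then show "(\<lambda>N. \<integral>\<omega>. D N \<omega> \<partial>M) \<longlonglongrightarrow> 0"
    using nonneg by (simp add: integral_eq_nn_integral)
qed

lemma norm_diff_square_le:
  fixes x y :: "'h::real_inner"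
  shows "(norm (x - y))\<^sup>2 \<le> 2 * (norm x)\<^sup>2 + 2 * (norm y)\<^sup>2"
  using zero_le_power2[of "norm (x + y)"]
  by (simp add: power2_norm_eq_inner inner_add_left inner_add_right inner_diff_left
      inner_diff_right inner_commute)

lemma abs_inner_le_norm_squares:
  fixes x y :: "'h::real_inner"
  shows "\<bar>inner x y\<bar> \<le> (norm x)\<^sup>2 + (norm y)\<^sup>2"
proof -
  have "\<bar>inner x y\<bar> \<le> norm x * norm y" by (rule Cauchy_Schwarz_ineq2)
  also have "\<dots> \<le> (norm x)\<^sup>2 + (norm y)\<^sup>2"
    using sum_squares_bound[of "norm x" "norm y"]
      mult_nonneg_nonneg[OF norm_ge_zero[of x] norm_ge_zero[of y]]
    by linarith
  finally show ?thesis .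
qed

text \<open>
  From \<open>\<parallel>x\<parallel>\<^sup>2 - \<parallel>y\<parallel>\<^sup>2 = \<parallel>x - y\<parallel>\<^sup>2 + 2 (x - y, y)\<close> and Young's inequality for the product.  Both sides
  contain squared norms only, so integration turns this into a bound between second moments.
\<close>
lemma abs_norm_square_diff_le:
  fixes x y :: "'h::real_inner"
  assumes "\<epsilon> > 0"
  shows "\<bar>(norm x)\<^sup>2 - (norm y)\<^sup>2\<bar> \<le> (1 + 1/\<epsilon>) * (norm (x - y))\<^sup>2 + \<epsilon> * (norm y)\<^sup>2"
proof -
  have "(norm x)\<^sup>2 - (norm y)\<^sup>2 = (norm (x - y))\<^sup>2 + 2 * inner (x - y) y"
    by (simp add: power2_norm_eq_inner inner_diff_left inner_diff_right inner_commute)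
  moreover have "\<bar>inner (x - y) y\<bar> \<le> norm (x - y) * norm y" by (rule Cauchy_Schwarz_ineq2)
  moreover have "2 * (norm (x - y) * norm y) \<le> (norm (x - y))\<^sup>2 / \<epsilon> + \<epsilon> * (norm y)\<^sup>2"
  proof -
    have "0 \<le> (norm (x - y) - \<epsilon> * norm y)\<^sup>2 / \<epsilon>" using assms by simp
    also have "\<dots> = (norm (x - y))\<^sup>2 / \<epsilon> + \<epsilon> * (norm y)\<^sup>2 - 2 * (norm (x - y) * norm y)"
      using assms by (simp add: field_simps power2_eq_square)
    finally show ?thesis by simp
  qed
  moreover have "(1 + 1/\<epsilon>) * (norm (x - y))\<^sup>2 = (norm (x - y))\<^sup>2 + (norm (x - y))\<^sup>2 / \<epsilon>"
    by (simp add: algebra_simps)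
  ultimately show ?thesis using zero_le_power2[of "norm (x - y)"] by linarith
qed

lemma mean_square_limit:
  fixes X :: "'w \<Rightarrow> 'h::real_inner" and e :: "nat \<Rightarrow> 'h"
  assumes e: "orthonormal_basis e"
    and X: "weakly_measurable M X" and Y: "\<And>N. weakly_measurable M (Y N)"
    and intY: "\<And>N. integrable M (\<lambda>\<omega>. (norm (Y N \<omega>))\<^sup>2)"
    and a: "(\<lambda>N. \<integral>\<omega>. (norm (Y N \<omega>))\<^sup>2 \<partial>M) \<longlonglongrightarrow> a"
    and lim: "(\<lambda>N. \<integral>\<^sup>+\<omega>. ennreal ((norm (X \<omega> - Y N \<omega>))\<^sup>2) \<partial>M) \<longlonglongrightarrow> 0"
  shows "integrable M (\<lambda>\<omega>. (norm (X \<omega>))\<^sup>2)"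
    and "(\<integral>\<omega>. (norm (X \<omega>))\<^sup>2 \<partial>M) = a"
proof -
  let ?D = "\<lambda>N \<omega>. (norm (X \<omega> - Y N \<omega>))\<^sup>2"
  have meas[measurable]: "?D N \<in> borel_measurable M" for N
    by (intro weakly_measurable_norm[OF e] weakly_measurable_diff X Y)
  have ev: "\<forall>\<^sub>F N in sequentially. integrable M (?D N)" by (rule nn_integral_tendsto_0(1)[OF meas _ lim]) simp
  have D0: "(\<lambda>N. \<integral>\<omega>. ?D N \<omega> \<partial>M) \<longlonglongrightarrow> 0" by (rule nn_integral_tendsto_0(2)[OF meas _ lim]) simp
  obtain N where N: "integrable M (?D N)"
    using eventually_happens'[OF sequentially_bot ev] by blast
  show intX: "integrable M (\<lambda>\<omega>. (norm (X \<omega>))\<^sup>2)"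
  proof (rule Bochner_Integration.integrable_bound)
    show "integrable M (\<lambda>\<omega>. 2 * ?D N \<omega> + 2 * (norm (Y N \<omega>))\<^sup>2)"
      using N intY by simp
    show "AE \<omega> in M. norm ((norm (X \<omega>))\<^sup>2) \<le> norm (2 * ?D N \<omega> + 2 * (norm (Y N \<omega>))\<^sup>2)"
      using norm_diff_square_le[of "X \<omega> - Y N \<omega>" "- Y N \<omega>" for \<omega>] by simp
  qed (rule weakly_measurable_norm[OF e X])
  let ?E = "\<integral>\<omega>. (norm (X \<omega>))\<^sup>2 \<partial>M"
  have "a \<ge> 0" by (rule LIMSEQ_le_const[OF a]) simp
  \<comment> \<open>The distance to \<open>Y N\<close> disappears in the limit for fixed \<open>\<epsilon>\<close>, although its factor \<open>1/\<epsilon>\<close> may be large.\<close>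
  have bound: "\<bar>?E - a\<bar> \<le> \<epsilon> * a" if "\<epsilon> > 0" for \<epsilon>
  proof (rule tendsto_le[OF sequentially_bot])
    show "(\<lambda>N. (1 + 1/\<epsilon>) * (\<integral>\<omega>. ?D N \<omega> \<partial>M) + \<epsilon> * (\<integral>\<omega>. (norm (Y N \<omega>))\<^sup>2 \<partial>M)) \<longlonglongrightarrow> \<epsilon> * a"
      using tendsto_add[OF tendsto_mult_left[OF D0, of "1 + 1/\<epsilon>"] tendsto_mult_left[OF a, of \<epsilon>]]
      by simp
    show "(\<lambda>N. \<bar>?E - (\<integral>\<omega>. (norm (Y N \<omega>))\<^sup>2 \<partial>M)\<bar>) \<longlonglongrightarrow> \<bar>?E - a\<bar>"
      by (intro tendsto_intros a)
    show "\<forall>\<^sub>F N in sequentially. \<bar>?E - (\<integral>\<omega>. (norm (Y N \<omega>))\<^sup>2 \<partial>M)\<bar>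
        \<le> (1 + 1/\<epsilon>) * (\<integral>\<omega>. ?D N \<omega> \<partial>M) + \<epsilon> * (\<integral>\<omega>. (norm (Y N \<omega>))\<^sup>2 \<partial>M)"
      using ev
    proof eventually_elim
      case (elim N)
      have "\<bar>?E - (\<integral>\<omega>. (norm (Y N \<omega>))\<^sup>2 \<partial>M)\<bar> = \<bar>\<integral>\<omega>. (norm (X \<omega>))\<^sup>2 - (norm (Y N \<omega>))\<^sup>2 \<partial>M\<bar>"
        using intX intY by simp
      also have "\<dots> \<le> (\<integral>\<omega>. (1 + 1/\<epsilon>) * ?D N \<omega> + \<epsilon> * (norm (Y N \<omega>))\<^sup>2 \<partial>M)"
        using intX intY elim abs_norm_square_diff_le[OF that]
        by (intro order_trans[OF integral_abs_bound] integral_mono) auto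
      also have "\<dots> = (1 + 1/\<epsilon>) * (\<integral>\<omega>. ?D N \<omega> \<partial>M) + \<epsilon> * (\<integral>\<omega>. (norm (Y N \<omega>))\<^sup>2 \<partial>M)"
        using intY elim by simp
      finally show ?case .
    qed
  qed
  show "?E = a"
  proof (rule ccontr)
    assume "?E \<noteq> a"
    then have "\<bar>?E - a\<bar> > 0" by simp
    \<comment> \<open>This choice of \<open>\<epsilon>\<close> makes \<open>\<epsilon> a\<close> less than half of \<open>\<bar>?E - a\<bar>\<close>, also for \<open>a = 0\<close>.\<close>
    then have "\<bar>?E - a\<bar> \<le> \<bar>?E - a\<bar> / (2 * (a + 1)) * a"
      using \<open>a \<ge> 0\<close> by (intro bound) simp
    also have "\<dots> = \<bar>?E - a\<bar> * (a / (2 * (a + 1)))" by simp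
    also have "\<dots> < \<bar>?E - a\<bar> * 1"
      using \<open>a \<ge> 0\<close> \<open>\<bar>?E - a\<bar> > 0\<close> by (intro mult_strict_left_mono) auto
    finally show False by simp
  qed
qed

context prob_space
begin

lemma integrable_inner_const:
  assumes X: "weakly_measurable M X" and "integrable M (\<lambda>\<omega>. (norm (X \<omega>))\<^sup>2)"
  shows "integrable M (\<lambda>\<omega>. inner (X \<omega>) v)"
proof (rule Bochner_Integration.integrable_bound)
  show "integrable M (\<lambda>\<omega>. (norm (X \<omega>))\<^sup>2 + (norm v)\<^sup>2)" using assms by simp
  show "AE \<omega> in M. norm (inner (X \<omega>) v) \<le> norm ((norm (X \<omega>))\<^sup>2 + (norm v)\<^sup>2)"
    using abs_inner_le_norm_squares by auto
qed (use X in measurable)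

text \<open>
  Nonnegativity of the variance, combined with the Cauchy--Schwarz inequality in the vector space.
\<close>
lemma expectation_inner_square_le:
  assumes X: "weakly_measurable M X" and int: "integrable M (\<lambda>\<omega>. (norm (X \<omega>))\<^sup>2)"
  shows "(expectation (\<lambda>\<omega>. inner (X \<omega>) v))\<^sup>2 \<le> (norm v)\<^sup>2 * expectation (\<lambda>\<omega>. (norm (X \<omega>))\<^sup>2)"
proof -
  have le: "(inner (X \<omega>) v)\<^sup>2 \<le> (norm v)\<^sup>2 * (norm (X \<omega>))\<^sup>2" for \<omega>
    using Cauchy_Schwarz_ineq[of "X \<omega>" v] by (simp add: power2_norm_eq_inner mult.commute)
  have int2: "integrable M (\<lambda>\<omega>. (inner (X \<omega>) v)\<^sup>2)"
  proof (rule Bochner_Integration.integrable_bound)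
    show "integrable M (\<lambda>\<omega>. (norm v)\<^sup>2 * (norm (X \<omega>))\<^sup>2)" using int by simp
    show "(\<lambda>\<omega>. (inner (X \<omega>) v)\<^sup>2) \<in> borel_measurable M" using X by measurable
  qed (use le in auto)
  have "0 \<le> variance (\<lambda>\<omega>. inner (X \<omega>) v)" by simp
  then have "(expectation (\<lambda>\<omega>. inner (X \<omega>) v))\<^sup>2 \<le> expectation (\<lambda>\<omega>. (inner (X \<omega>) v)\<^sup>2)"
    using variance_eq[OF integrable_inner_const[OF X int] int2] by simp
  also have "\<dots> \<le> expectation (\<lambda>\<omega>. (norm v)\<^sup>2 * (norm (X \<omega>))\<^sup>2)"
    using int int2 le by (intro integral_mono) auto
  finally show ?thesis using int by simp
qed

text \<open>
  The mean in direction \<open>v\<close> is unchanged when the centered \<open>Y N\<close> is subtracted from \<open>X\<close>, and the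
  mean of \<open>X - Y N\<close> is controlled by its second moment, which tends to \<open>0\<close>.
\<close>
lemma mean_square_limit_centered:
  fixes X :: "'a \<Rightarrow> 'h::real_inner" and e :: "nat \<Rightarrow> 'h"
  assumes e: "orthonormal_basis e"
    and X: "weakly_measurable M X" and Y: "\<And>N. weakly_measurable M (Y N)"
    and intX: "integrable M (\<lambda>\<omega>. (norm (X \<omega>))\<^sup>2)"
    and intY: "\<And>N. integrable M (\<lambda>\<omega>. (norm (Y N \<omega>))\<^sup>2)"
    and mean: "\<And>N. expectation (\<lambda>\<omega>. inner (Y N \<omega>) v) = 0"
    and lim: "(\<lambda>N. \<integral>\<^sup>+\<omega>. ennreal ((norm (X \<omega> - Y N \<omega>))\<^sup>2) \<partial>M) \<longlonglongrightarrow> 0"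
  shows "expectation (\<lambda>\<omega>. inner (X \<omega>) v) = 0"
proof -
  let ?D = "\<lambda>N \<omega>. (norm (X \<omega> - Y N \<omega>))\<^sup>2"
  have D: "weakly_measurable M (\<lambda>\<omega>. X \<omega> - Y N \<omega>)" for N
    by (intro weakly_measurable_diff X Y)
  have meas: "?D N \<in> borel_measurable M" for N
    by (rule weakly_measurable_norm[OF e D])
  have "(expectation (\<lambda>\<omega>. inner (X \<omega>) v))\<^sup>2 \<le> (norm v)\<^sup>2 * 0"
  proof (rule tendsto_le[OF sequentially_bot])
    show "(\<lambda>N. (norm v)\<^sup>2 * expectation (?D N)) \<longlonglongrightarrow> (norm v)\<^sup>2 * 0"
      by (intro tendsto_mult_left nn_integral_tendsto_0(2)[OF meas _ lim]) simp
    show "\<forall>\<^sub>F N in sequentially.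
        (expectation (\<lambda>\<omega>. inner (X \<omega>) v))\<^sup>2 \<le> (norm v)\<^sup>2 * expectation (?D N)"
      using nn_integral_tendsto_0(1)[OF meas zero_le_power2 lim]
    proof eventually_elim
      case (elim N)
      have "expectation (\<lambda>\<omega>. inner (X \<omega>) v) = expectation (\<lambda>\<omega>. inner (X \<omega> - Y N \<omega>) v)"
        using integrable_inner_const[OF X intX] integrable_inner_const[OF Y intY] mean
        by (simp add: inner_diff_left)
      then show ?case using expectation_inner_square_le[OF D elim] by simp
    qed
  qed (rule tendsto_const)
  then show ?thesis by simp
qed

section \<open>Increments of the Wiener process\<close>

lemma uncorrelated_sum:
  fixes \<xi> :: "nat \<Rightarrow> 'a \<Rightarrow> real" and a :: "nat \<Rightarrow> 'h::real_inner"
  assumes int: "\<And>i j. integrable M (\<lambda>\<omega>. \<xi> i \<omega> * \<xi> j \<omega>)"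
    and cov: "\<And>i j. expectation (\<lambda>\<omega>. \<xi> i \<omega> * \<xi> j \<omega>) = (if i = j then c else 0)"
  shows "integrable M (\<lambda>\<omega>. (norm (\<Sum>j<N. \<xi> j \<omega> *\<^sub>R a j))\<^sup>2)"
    and "expectation (\<lambda>\<omega>. (norm (\<Sum>j<N. \<xi> j \<omega> *\<^sub>R a j))\<^sup>2) = c * (\<Sum>j<N. (norm (a j))\<^sup>2)"
proof -
  have eq: "(norm (\<Sum>j<N. \<xi> j \<omega> *\<^sub>R a j))\<^sup>2
      = (\<Sum>i<N. \<Sum>j<N. (\<xi> i \<omega> * \<xi> j \<omega>) * inner (a i) (a j))" for \<omega>
    unfolding power2_norm_eq_inner inner_sum_left
    by (simp add: inner_sum_right sum_distrib_left mult.assoc mult.left_commute)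
  show "integrable M (\<lambda>\<omega>. (norm (\<Sum>j<N. \<xi> j \<omega> *\<^sub>R a j))\<^sup>2)"
    unfolding eq using int by simp
  have "expectation (\<lambda>\<omega>. (norm (\<Sum>j<N. \<xi> j \<omega> *\<^sub>R a j))\<^sup>2)
      = (\<Sum>i<N. \<Sum>j<N. (if i = j then c else 0) * inner (a i) (a j))"
    unfolding eq using int by (simp add: cov)
  also have "\<dots> = (\<Sum>i<N. c * inner (a i) (a i))"
    by (simp add: if_distrib[of "\<lambda>x. x * _"] cong: if_cong)
  finally show "expectation (\<lambda>\<omega>. (norm (\<Sum>j<N. \<xi> j \<omega> *\<^sub>R a j))\<^sup>2) = c * (\<Sum>j<N. (norm (a j))\<^sup>2)"
    by (simp add: power2_norm_eq_inner sum_distrib_left)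
qed

lemma brownian_increment_moments:
  assumes B: "standard_brownian_motion M \<beta>" and st: "0 \<le> s" "s < t"
  defines "\<xi> \<equiv> \<lambda>\<omega>. \<beta> t \<omega> - \<beta> s \<omega>"
  shows "integrable M \<xi>" and "expectation \<xi> = 0"
    and "integrable M (\<lambda>\<omega>. \<xi> \<omega> * \<xi> \<omega>)" and "expectation (\<lambda>\<omega>. \<xi> \<omega> * \<xi> \<omega>) = t - s"
proof -
  let ?\<sigma> = "sqrt (t - s)"
  have pos: "0 < ?\<sigma>" using st by simp
  have D: "distributed M lborel \<xi> (normal_density 0 ?\<sigma>)"
    using B st by (simp add: standard_brownian_motion_def \<xi>_def)
  show 1: "expectation \<xi> = 0"
    by (rule normal_distributed_expectation[OF pos D])
  show "integrable M \<xi>"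
    using integrable_normal_moment[OF pos, of 0 1] distributed_integrable[OF D, of "\<lambda>x. x"] by simp
  show "integrable M (\<lambda>\<omega>. \<xi> \<omega> * \<xi> \<omega>)"
    using integrable_normal_moment[OF pos, of 0 2] distributed_integrable[OF D, of "\<lambda>x. x * x"]
    by (simp add: power2_eq_square)
  show "expectation (\<lambda>\<omega>. \<xi> \<omega> * \<xi> \<omega>) = t - s"
    using normal_distributed_variance[OF pos D] st by (simp add: 1 power2_eq_square)
qed

text \<open>
  Independence is assumed between the entire paths; evaluation at two times is a measurable map on
  path space, so it passes to the increments.
\<close>
lemma brownian_increments_uncorrelated:
  assumes B: "\<And>j. standard_brownian_motion M (\<beta> j)"
    and indep: "indep_vars (\<lambda>j. Pi\<^sub>M {0..} (\<lambda>_. borel)) (\<lambda>j \<omega>. \<lambda>t\<in>{0..}. \<beta> j t \<omega>) (UNIV :: nat set)"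
    and st: "0 \<le> s" "s < t"
  defines "\<xi> \<equiv> \<lambda>j \<omega>. \<beta> j t \<omega> - \<beta> j s \<omega>"
  shows "integrable M (\<lambda>\<omega>. \<xi> i \<omega> * \<xi> j \<omega>)"
    and "expectation (\<lambda>\<omega>. \<xi> i \<omega> * \<xi> j \<omega>) = (if i = j then t - s else 0)"
proof -
  have \<xi>: "\<xi> j \<omega> = \<beta> j t \<omega> - \<beta> j s \<omega>" for j \<omega>
    by (simp add: \<xi>_def)
  note mom = brownian_increment_moments[OF B st, folded \<xi>]
  have "indep_vars (\<lambda>_. borel) (\<lambda>j \<omega>. (\<lambda>f. f t - f s) (\<lambda>r\<in>{0..}. \<beta> j r \<omega>)) (UNIV :: nat set)"
    using st by (intro indep_vars_compose2[OF indep]) (auto intro!: borel_measurable_diff)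
  then have ind: "indep_vars (\<lambda>_. borel) \<xi> UNIV"
    using st by (simp add: \<xi>_def)
  have "integrable M (\<lambda>\<omega>. \<xi> i \<omega> * \<xi> j \<omega>) \<and> expectation (\<lambda>\<omega>. \<xi> i \<omega> * \<xi> j \<omega>) = 0" if "i \<noteq> j"
    using that mom
      indep_vars_integrable[OF _ indep_vars_subset[OF ind], of "{i, j}"]
      indep_vars_lebesgue_integral[OF _ indep_vars_subset[OF ind], of "{i, j}"]
    by simp
  then show "integrable M (\<lambda>\<omega>. \<xi> i \<omega> * \<xi> j \<omega>)"
    and "expectation (\<lambda>\<omega>. \<xi> i \<omega> * \<xi> j \<omega>) = (if i = j then t - s else 0)"
    using mom by (cases "i = j"; simp)+
qed

lemma Q_wiener_weakly_measurable:
  assumes "normal_filtration M F" and "Q_wiener_process M F Q W" and "0 \<le> t"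
  shows "weakly_measurable (F t) (W t)" and "weakly_measurable M (W t)"
proof -
  show "weakly_measurable (F t) (W t)"
    using assms by (intro borel_measurable_imp_weakly_measurable) (simp add: Q_wiener_process_def)
  then show "weakly_measurable M (W t)"
    using assms by (auto simp: normal_filtration_def intro: weakly_measurable_subalgebra)
qed

text \<open>
  The increment is the limit in mean square of \<open>Y N = \<Sum>j<N. (\<beta>\<^sub>j t - \<beta>\<^sub>j s) R e\<^sub>j\<close>.  Its coefficients
  are centered and uncorrelated with variance \<open>t - s\<close>, so the second moment of \<open>Y N\<close> is
  \<open>(t - s) (\<Sum>j<N. \<parallel>R e\<^sub>j\<parallel>\<^sup>2)\<close>, and its mean is \<open>0\<close>; both facts survive the limit.
\<close>
lemma Q_wiener_increment:
  fixes W :: "real \<Rightarrow> 'a \<Rightarrow> 'h::real_inner"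
  assumes F: "normal_filtration M F" and W: "Q_wiener_process M F Q W" and Q: "trace_class Q"
    and st: "0 \<le> s" "s < t"
  shows "integrable M (\<lambda>\<omega>. (norm (W t \<omega> - W s \<omega>))\<^sup>2)"
    and "expectation (\<lambda>\<omega>. (norm (W t \<omega> - W s \<omega>))\<^sup>2) = (t - s) * op_trace Q"
    and "expectation (\<lambda>\<omega>. inner (W t \<omega> - W s \<omega>) v) = 0"
proof -
  from W obtain R e \<beta> where R: "is_op_sqrt R Q" and e: "orthonormal_basis e"
    and B: "\<And>j. standard_brownian_motion M (\<beta> j)"
    and indep: "indep_vars (\<lambda>j. Pi\<^sub>M {0..} (\<lambda>_. borel)) (\<lambda>j \<omega>. \<lambda>t\<in>{0..}. \<beta> j t \<omega>) (UNIV :: nat set)"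
    and lim: "\<And>t. 0 \<le> t \<Longrightarrow>
      (\<lambda>N. \<integral>\<^sup>+\<omega>. ennreal ((norm (W t \<omega> - (\<Sum>j<N. \<beta> j t \<omega> *\<^sub>R R (e j))))\<^sup>2) \<partial>M) \<longlonglongrightarrow> 0"
    unfolding Q_wiener_process_def by blast
  define \<xi> where "\<xi> j \<omega> = \<beta> j t \<omega> - \<beta> j s \<omega>" for j \<omega>
  define Y where "Y N \<omega> = (\<Sum>j<N. \<xi> j \<omega> *\<^sub>R R (e j))" for N \<omega>
  let ?X = "\<lambda>\<omega>. W t \<omega> - W s \<omega>"
  let ?T = "\<lambda>r N \<omega>. W r \<omega> - (\<Sum>j<N. \<beta> j r \<omega> *\<^sub>R R (e j))"
  have \<beta>m: "\<beta> j r \<in> borel_measurable M" if "0 \<le> r" for j r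
    using B that by (simp add: standard_brownian_motion_def)
  have Wm: "weakly_measurable M (W r)" if "0 \<le> r" for r
    by (rule Q_wiener_weakly_measurable(2)[OF F W that])
  have X: "weakly_measurable M ?X"
    using st by (intro weakly_measurable_diff Wm) auto
  have Y: "weakly_measurable M (Y N)" for N
    unfolding Y_def \<xi>_def using st
    by (intro weakly_measurable_sum_scaleR borel_measurable_diff \<beta>m) auto
  note mom = brownian_increment_moments[OF B st, folded \<xi>_def]
  note cov = brownian_increments_uncorrelated[OF B indep st, folded \<xi>_def]
  note var = uncorrelated_sum[where a = "\<lambda>j. R (e j)", OF cov, folded Y_def]
  have a: "(\<lambda>N. expectation (\<lambda>\<omega>. (norm (Y N \<omega>))\<^sup>2)) \<longlonglongrightarrow> (t - s) * op_trace Q"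
    unfolding var(2) using trace_class_sums[OF Q R e] by (auto simp: sums_def intro: tendsto_mult_left)
  have mean: "expectation (\<lambda>\<omega>. inner (Y N \<omega>) v) = 0" for N
    using mom by (simp add: Y_def inner_sum_left)
  \<comment> \<open>The expansion is assumed at single times; the errors at \<open>s\<close> and \<open>t\<close> bound that of the increment.\<close>
  have limX: "(\<lambda>N. \<integral>\<^sup>+\<omega>. ennreal ((norm (?X \<omega> - Y N \<omega>))\<^sup>2) \<partial>M) \<longlonglongrightarrow> 0"
  proof (rule tendsto_sandwich[OF _ _ tendsto_const])
    have Tm: "(\<lambda>\<omega>. ennreal ((norm (?T r N \<omega>))\<^sup>2)) \<in> borel_measurable M" if "0 \<le> r" for r N
      using that
      by (intro measurable_compose[OF weakly_measurable_norm[OF e] measurable_ennreal]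
          weakly_measurable_diff Wm weakly_measurable_sum_scaleR \<beta>m)
    have le: "ennreal ((norm (?X \<omega> - Y N \<omega>))\<^sup>2)
        \<le> 2 * ennreal ((norm (?T t N \<omega>))\<^sup>2) + 2 * ennreal ((norm (?T s N \<omega>))\<^sup>2)" for N \<omega>
    proof -
      have eq: "?X \<omega> - Y N \<omega> = ?T t N \<omega> - ?T s N \<omega>"
        by (simp add: Y_def \<xi>_def scaleR_diff_left sum_subtractf algebra_simps)
      have "(norm (?X \<omega> - Y N \<omega>))\<^sup>2 \<le> 2 * (norm (?T t N \<omega>))\<^sup>2 + 2 * (norm (?T s N \<omega>))\<^sup>2"
        unfolding eq by (rule norm_diff_square_le)
      then have "ennreal ((norm (?X \<omega> - Y N \<omega>))\<^sup>2)
          \<le> ennreal (2 * (norm (?T t N \<omega>))\<^sup>2 + 2 * (norm (?T s N \<omega>))\<^sup>2)"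
        by (rule ennreal_leI)
      then show ?thesis by (simp add: ennreal_mult)
    qed
    show "\<forall>\<^sub>F N in sequentially. (\<integral>\<^sup>+\<omega>. ennreal ((norm (?X \<omega> - Y N \<omega>))\<^sup>2) \<partial>M)
        \<le> 2 * (\<integral>\<^sup>+\<omega>. ennreal ((norm (?T t N \<omega>))\<^sup>2) \<partial>M) + 2 * (\<integral>\<^sup>+\<omega>. ennreal ((norm (?T s N \<omega>))\<^sup>2) \<partial>M)"
    proof (rule always_eventually, rule allI)
      fix N
      have "(\<integral>\<^sup>+\<omega>. ennreal ((norm (?X \<omega> - Y N \<omega>))\<^sup>2) \<partial>M)
        \<le> (\<integral>\<^sup>+\<omega>. 2 * ennreal ((norm (?T t N \<omega>))\<^sup>2) + 2 * ennreal ((norm (?T s N \<omega>))\<^sup>2) \<partial>M)"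
        by (intro nn_integral_mono le)
      also have "\<dots> = 2 * (\<integral>\<^sup>+\<omega>. ennreal ((norm (?T t N \<omega>))\<^sup>2) \<partial>M)
          + 2 * (\<integral>\<^sup>+\<omega>. ennreal ((norm (?T s N \<omega>))\<^sup>2) \<partial>M)"
        using st Tm by (simp add: nn_integral_add nn_integral_cmult)
      finally show "(\<integral>\<^sup>+\<omega>. ennreal ((norm (?X \<omega> - Y N \<omega>))\<^sup>2) \<partial>M) \<le> \<dots>" .
    qed
    have "(\<lambda>N. 2 * (\<integral>\<^sup>+\<omega>. ennreal ((norm (?T t N \<omega>))\<^sup>2) \<partial>M)
        + 2 * (\<integral>\<^sup>+\<omega>. ennreal ((norm (?T s N \<omega>))\<^sup>2) \<partial>M)) \<longlonglongrightarrow> 2 * 0 + 2 * 0"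
      using st by (intro tendsto_add ennreal_tendsto_cmult lim) auto
    then show "(\<lambda>N. 2 * (\<integral>\<^sup>+\<omega>. ennreal ((norm (?T t N \<omega>))\<^sup>2) \<partial>M)
        + 2 * (\<integral>\<^sup>+\<omega>. ennreal ((norm (?T s N \<omega>))\<^sup>2) \<partial>M)) \<longlonglongrightarrow> 0" by simp
  qed simp
  show intX: "integrable M (\<lambda>\<omega>. (norm (?X \<omega>))\<^sup>2)"
    and "expectation (\<lambda>\<omega>. (norm (?X \<omega>))\<^sup>2) = (t - s) * op_trace Q"
    using mean_square_limit[OF e X Y var(1) a limX] by auto
  show "expectation (\<lambda>\<omega>. inner (?X \<omega>) v) = 0"
    by (rule mean_square_limit_centered[OF e X Y intX var(1) mean limX])
qed

section \<open>Orthogonality of independent vectors\<close>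

lemma indep_var_of_indep_set:
  assumes G: "space G = space M" "sets G \<subseteq> events" and H: "space H = space M" "sets H \<subseteq> events"
    and indep: "indep_set (sets G) (sets H)"
    and f: "f \<in> borel_measurable G" and g: "g \<in> borel_measurable H"
  shows "indep_var borel f borel g"
proof -
  have sub: "sigma_sets (space M) {h -` A \<inter> space M |A. A \<in> sets borel} \<subseteq> sets K"
    if "space K = space M" "h \<in> borel_measurable K" for K :: "'a measure" and h
    unfolding that(1)[symmetric] using measurable_sets[OF that(2)]
    by (intro sets.sigma_sets_subset) blast
  have "f \<in> borel_measurable M" "g \<in> borel_measurable M"
    using f g G H by (auto simp: measurable_def)
  then show ?thesis
    using indep sub[OF G(1) f] sub[OF H(1) g]
    unfolding indep_var_eq indep_sets2_eq by blast
qed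

text \<open>
  In each coordinate, the expectation of the product factorizes by independence and is \<open>0\<close>, as \<open>Y\<close>
  is centered.  The partial sums of the coordinate expansion converge to the inner product and are
  dominated by \<open>\<parallel>X\<parallel>\<^sup>2 + \<parallel>Y\<parallel>\<^sup>2\<close> thanks to Bessel's inequality.
\<close>
lemma expectation_inner_independent:
  fixes X Y :: "'a \<Rightarrow> 'h::real_inner" and e :: "nat \<Rightarrow> 'h"
  assumes e: "orthonormal_basis e" and G: "subalgebra M G"
    and X: "weakly_measurable G X" and Y: "weakly_measurable M Y"
    and indep: "indep_set (sets G) (generated_sets M borel Y)"
    and intX: "integrable M (\<lambda>\<omega>. (norm (X \<omega>))\<^sup>2)" and intY: "integrable M (\<lambda>\<omega>. (norm (Y \<omega>))\<^sup>2)"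
    and mean: "\<And>v. expectation (\<lambda>\<omega>. inner (Y \<omega>) v) = 0"
  shows "integrable M (\<lambda>\<omega>. inner (X \<omega>) (Y \<omega>))"
    and "expectation (\<lambda>\<omega>. inner (X \<omega>) (Y \<omega>)) = 0"
proof -
  let ?H = "vimage_algebra (space M) Y borel"
  have XM: "weakly_measurable M X" by (rule weakly_measurable_subalgebra[OF X G])
  have YH: "weakly_measurable ?H Y"
    by (intro borel_measurable_imp_weakly_measurable measurable_vimage_algebra1) simp
  have indep': "indep_set (sets G) (sets ?H)" using indep by (simp add: generated_sets_def)
  have var: "indep_var borel (\<lambda>\<omega>. inner (X \<omega>) v) borel (\<lambda>\<omega>. inner (Y \<omega>) v)" for v
    using G X YH indep_setD_ev2[OF indep']
    by (intro indep_var_of_indep_set[OF _ _ _ _ indep'])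
       (auto simp: subalgebra_def weakly_measurable_def)
  let ?f = "\<lambda>N \<omega>. \<Sum>j<N. inner (X \<omega>) (e j) * inner (Y \<omega>) (e j)"
  have product: "integrable M (\<lambda>\<omega>. inner (X \<omega>) v * inner (Y \<omega>) v)"
    "expectation (\<lambda>\<omega>. inner (X \<omega>) v * inner (Y \<omega>) v) = 0" for v
    using indep_var_integrable[OF var integrable_inner_const[OF XM intX] integrable_inner_const[OF Y intY]]
      indep_var_lebesgue_integral[OF var integrable_inner_const[OF XM intX] integrable_inner_const[OF Y intY]]
    by (simp_all add: mean)
  have f0: "expectation (?f N) = 0" for N by (simp add: product)
  have meas: "(\<lambda>\<omega>. inner (X \<omega>) (Y \<omega>)) \<in> borel_measurable M"
    by (rule weakly_measurable_inner[OF e XM Y])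
  have fm: "?f N \<in> borel_measurable M" for N
    using product(1) by (intro borel_measurable_sum borel_measurable_integrable)
  have w: "integrable M (\<lambda>\<omega>. (norm (X \<omega>))\<^sup>2 + (norm (Y \<omega>))\<^sup>2)" using intX intY by simp
  have lim: "AE \<omega> in M. (\<lambda>N. ?f N \<omega>) \<longlonglongrightarrow> inner (X \<omega>) (Y \<omega>)"
    using parseval_inner[OF e] by (simp add: sums_def)
  have bound: "AE \<omega> in M. norm (?f N \<omega>) \<le> (norm (X \<omega>))\<^sup>2 + (norm (Y \<omega>))\<^sup>2" for N
  proof (rule AE_I2)
    fix \<omega>
    have "norm (?f N \<omega>) \<le> (norm (fourier_sum e N (X \<omega>)))\<^sup>2 + (norm (Y \<omega>))\<^sup>2"
      using abs_inner_le_norm_squares[of "fourier_sum e N (X \<omega>)" "Y \<omega>"]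
      by (simp add: inner_fourier_sum_left)
    also have "\<dots> \<le> (norm (X \<omega>))\<^sup>2 + (norm (Y \<omega>))\<^sup>2"
      using norm_fourier_sum_le[OF e] by (simp add: power_mono)
    finally show "norm (?f N \<omega>) \<le> (norm (X \<omega>))\<^sup>2 + (norm (Y \<omega>))\<^sup>2" .
  qed
  show "integrable M (\<lambda>\<omega>. inner (X \<omega>) (Y \<omega>))"
    by (rule integrable_dominated_convergence[OF meas fm w lim bound])
  have "(\<lambda>N. expectation (?f N)) \<longlonglongrightarrow> expectation (\<lambda>\<omega>. inner (X \<omega>) (Y \<omega>))"
    by (rule integral_dominated_convergence[OF meas fm w lim bound])
  then show "expectation (\<lambda>\<omega>. inner (X \<omega>) (Y \<omega>)) = 0"
    unfolding f0 by (simp add: LIMSEQ_const_iff)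
qed

end

section \<open>Mass and unitary groups\<close>

lemma mass_eq_norm_square: "mass u = (norm u)\<^sup>2"
proof -
  have "mass u = inner u u"
  proof transfer
    fix f :: "'a \<Rightarrow> complex"
    show "(LINT x|lborel. (cmod (f x))\<^sup>2) = Re (LINT x|lborel. f x * cnj (f x))"
      by (simp add: complex_norm_square[symmetric] del: of_real_power)
  qed
  then show ?thesis by (simp only: power2_norm_eq_inner)
qed

lemma inner_ii_left: "inner (\<i> *\<^sub>C u) v = - inner u (\<i> *\<^sub>C v)"
proof transfer
  fix f g :: "'a \<Rightarrow> complex"
  have "(\<lambda>x. \<i> * f x * cnj (g x)) = (\<lambda>x. - (f x * cnj (\<i> * g x)))"
    by (simp add: mult_ac)
  then show "Re (LINT x|lborel. \<i> * f x * cnj (g x)) = - Re (LINT x|lborel. f x * cnj (\<i> * g x))"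
    by simp
qed

lemma ii_scaleC_ii_scaleC: "\<i> *\<^sub>C \<i> *\<^sub>C u = - u"
  by transfer (auto simp: L2_rel_def mult.assoc[symmetric]
      square_integrable_scale[where c = "-1", simplified])

lemma norm_ii_scaleC: "norm (\<i> *\<^sub>C u) = norm u"
  by (simp add: norm_eq_sqrt_inner inner_ii_left ii_scaleC_ii_scaleC)

lemma unitary_group_diff:
  assumes "unitary_group S"
  shows "S t (u - v) = S t u - S t v"
proof -
  have "S t (u - v) + S t v = S t (u - v + v)"
    using assms by (simp only: unitary_group_def)
  then show ?thesis by (simp add: algebra_simps)
qed

text \<open>
  A surjective isometry preserves the inner product by polarization, so its adjoint is its
  inverse.  This transports weak measurability along \<open>S t\<close>.
\<close>
lemma unitary_group_inner:
  assumes "unitary_group S"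
  shows "inner (S t u) v = inner u (S (- t) v)"
proof -
  have add: "S t (x + y) = S t x + S t y" and iso: "norm (S t x) = norm x" for x y
    using assms by (auto simp: unitary_group_def)
  have "S t (S (- t) v) = v"
    using assms unfolding unitary_group_def by (metis add.right_inverse)
  moreover have "inner (S t x) (S t y) = inner x y" for x y
    unfolding dot_norm add[symmetric] iso ..
  ultimately show ?thesis by metis
qed

text \<open>
  The noise enters through the same isometry \<open>S k\<close> as the iterate, which can therefore be dropped.
  In the cross term, multiplication by \<open>\<i>\<close> is moved from the noise to the iterate, so that the
  noise appears alone in one factor.
\<close>
lemma exponential_integrator_step_norm:
  assumes S: "unitary_group S"
  shows "(norm (S k u - \<i> *\<^sub>C S k w))\<^sup>2 = (norm u)\<^sup>2 + (norm w)\<^sup>2 + 2 * inner (\<i> *\<^sub>C u) w"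
proof -
  have "S k u - \<i> *\<^sub>C S k w = S k (u - \<i> *\<^sub>C w)"
    using S by (simp add: unitary_group_diff[OF S]) (simp add: unitary_group_def)
  then have "norm (S k u - \<i> *\<^sub>C S k w) = norm (u - \<i> *\<^sub>C w)"
    using S by (simp add: unitary_group_def)
  then have "(norm (S k u - \<i> *\<^sub>C S k w))\<^sup>2 = inner (u - \<i> *\<^sub>C w) (u - \<i> *\<^sub>C w)"
    by (simp only: power2_norm_eq_inner)
  also have "\<dots> = inner u u + inner (\<i> *\<^sub>C w) (\<i> *\<^sub>C w) - 2 * inner u (\<i> *\<^sub>C w)"
    by (simp add: inner_diff_left inner_diff_right inner_commute)
  also have "\<dots> = (norm u)\<^sup>2 + (norm (\<i> *\<^sub>C w))\<^sup>2 + 2 * inner (\<i> *\<^sub>C u) w"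
    by (simp only: power2_norm_eq_inner inner_ii_left)
  finally show ?thesis by (simp only: norm_ii_scaleC)
qed

lemma weakly_measurable_ii_scaleC:
  "weakly_measurable M X \<Longrightarrow> weakly_measurable M (\<lambda>\<omega>. \<i> *\<^sub>C X \<omega>)"
  by (auto simp: weakly_measurable_def inner_ii_left)

lemma weakly_measurable_unitary_group:
  "unitary_group S \<Longrightarrow> weakly_measurable M X \<Longrightarrow> weakly_measurable M (\<lambda>\<omega>. S t (X \<omega>))"
  unfolding weakly_measurable_def by (simp only: unitary_group_inner) blast

section \<open>Evolution of the mass\<close>

lemma weakly_measurable_filtration_mono:
  assumes F: "normal_filtration M F" and st: "0 \<le> s" "s \<le> t" and X: "weakly_measurable (F s) X"
  shows "weakly_measurable (F t) X"
proof (rule weakly_measurable_subalgebra[OF X])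
  have "subalgebra M (F s)" "subalgebra M (F t)" "sets (F s) \<subseteq> sets (F t)"
    using F[unfolded normal_filtration_def, THEN conjunct1]
      F[unfolded normal_filtration_def, THEN conjunct2, THEN conjunct1] st by auto
  then show "subalgebra (F t) (F s)"
    by (simp add: subalgebra_def)
qed

text \<open>
  The \<open>n\<close>-th iterate only involves the noise up to time \<open>n k\<close>, hence it is independent of the next
  increment.
\<close>
lemma exponential_integrator_adapted:
  fixes u0 :: "'w \<Rightarrow> 'a::euclidean_space L2"
  assumes "prob_space M" and F: "normal_filtration M F" and S: "unitary_group S"
    and W: "Q_wiener_process M F Q W" and u0: "u0 \<in> borel_measurable (F 0)" and k: "k > 0"
  shows "weakly_measurable (F (real n * k)) (exponential_integrator S k W u0 n)"
proof (induction n)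
  case 0
  have "exponential_integrator S k W u0 0 = u0" by auto
  then show ?case using borel_measurable_imp_weakly_measurable[OF u0] by simp
next
  case (Suc n)
  interpret prob_space M by fact
  let ?s = "real n * k" and ?t = "real (Suc n) * k"
  have st: "0 \<le> ?s" "?s \<le> ?t" "0 \<le> ?t" using k by (auto simp: algebra_simps)
  note mono = weakly_measurable_filtration_mono[OF F st(1,2)]
  have "weakly_measurable (F ?t) (\<lambda>\<omega>. S k (exponential_integrator S k W u0 n \<omega>)
       - \<i> *\<^sub>C S k (W ?t \<omega> - W ?s \<omega>))"
    by (intro weakly_measurable_diff weakly_measurable_ii_scaleC
        weakly_measurable_unitary_group[OF S] mono[OF Suc.IH] mono[OF Q_wiener_weakly_measurable(1)[OF F W st(1)]]
        Q_wiener_weakly_measurable(1)[OF F W st(3)])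
  moreover have "exponential_integrator S k W u0 (Suc n)
      = (\<lambda>\<omega>. S k (exponential_integrator S k W u0 n \<omega>) - \<i> *\<^sub>C S k (W ?t \<omega> - W ?s \<omega>))"
    by (rule ext) simp
  ultimately show ?case by (simp only:)
qed

lemma exponential_integrator_step_mass:
  fixes u0 :: "'w \<Rightarrow> 'a::euclidean_space L2"
  assumes P: "prob_space M" and F: "normal_filtration M F" and S: "unitary_group S"
    and W: "Q_wiener_process M F Q W" and u0: "u0 \<in> borel_measurable (F 0)" and k: "k > 0"
    and Q: "trace_class Q"
    and int: "integrable M (\<lambda>\<omega>. (norm (exponential_integrator S k W u0 n \<omega>))\<^sup>2)"
  shows "integrable M (\<lambda>\<omega>. (norm (exponential_integrator S k W u0 (Suc n) \<omega>))\<^sup>2)"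
    and "prob_space.expectation M (\<lambda>\<omega>. (norm (exponential_integrator S k W u0 (Suc n) \<omega>))\<^sup>2)
      = prob_space.expectation M (\<lambda>\<omega>. (norm (exponential_integrator S k W u0 n \<omega>))\<^sup>2)
        + k * op_trace Q"
proof -
  interpret prob_space M by fact
  let ?s = "real n * k" and ?t = "real (Suc n) * k" and ?u = "exponential_integrator S k W u0 n"
  let ?w = "\<lambda>\<omega>. W ?t \<omega> - W ?s \<omega>"
  have st: "0 \<le> ?s" "?s < ?t" "0 \<le> ?t" "?s \<le> ?t" using k by (auto simp: algebra_simps)
  from W obtain e :: "nat \<Rightarrow> 'a L2" where e: "orthonormal_basis e"
    unfolding Q_wiener_process_def by blast
  note noise = Q_wiener_increment[OF F W Q st(1,2)]
  have G: "subalgebra M (F ?s)" using F st by (simp add: normal_filtration_def)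
  have iu: "weakly_measurable (F ?s) (\<lambda>\<omega>. \<i> *\<^sub>C ?u \<omega>)"
    by (intro weakly_measurable_ii_scaleC exponential_integrator_adapted[OF P F S W u0 k])
  have w: "weakly_measurable M ?w"
    by (intro weakly_measurable_diff Q_wiener_weakly_measurable(2)[OF F W] st)
  have indep: "indep_set (sets (F ?s)) (generated_sets M borel ?w)"
    using W st unfolding Q_wiener_process_def by blast
  have "integrable M (\<lambda>\<omega>. (norm (\<i> *\<^sub>C ?u \<omega>))\<^sup>2)" using int by (simp only: norm_ii_scaleC)
  note cross = expectation_inner_independent[OF e G iu w indep this noise(1) noise(3)]
  have step: "(norm (exponential_integrator S k W u0 (Suc n) \<omega>))\<^sup>2
      = (norm (?u \<omega>))\<^sup>2 + (norm (?w \<omega>))\<^sup>2 + 2 * inner (\<i> *\<^sub>C ?u \<omega>) (?w \<omega>)" for \<omega>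
    unfolding exponential_integrator.simps by (rule exponential_integrator_step_norm[OF S])
  show "integrable M (\<lambda>\<omega>. (norm (exponential_integrator S k W u0 (Suc n) \<omega>))\<^sup>2)"
    unfolding step
    by (intro Bochner_Integration.integrable_add integrable_mult_right int noise(1) cross(1))
  have "expectation (\<lambda>\<omega>. (norm (exponential_integrator S k W u0 (Suc n) \<omega>))\<^sup>2)
      = expectation (\<lambda>\<omega>. (norm (?u \<omega>))\<^sup>2) + (?t - ?s) * op_trace Q"
    unfolding step using int noise(1,2) cross by simp
  also have "?t - ?s = k" by (simp add: algebra_simps)
  finally show "expectation (\<lambda>\<omega>. (norm (exponential_integrator S k W u0 (Suc n) \<omega>))\<^sup>2)
      = expectation (\<lambda>\<omega>. (norm (?u \<omega>))\<^sup>2) + k * op_trace Q" .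
qed

lemma exponential_integrator_mass:
  fixes u0 :: "'w \<Rightarrow> 'a::euclidean_space L2"
  assumes P: "prob_space M" and F: "normal_filtration M F" and S: "unitary_group S"
    and W: "Q_wiener_process M F Q W" and u0: "u0 \<in> borel_measurable (F 0)" and k: "k > 0"
    and Q: "trace_class Q" and int: "integrable M (\<lambda>\<omega>. (norm (u0 \<omega>))\<^sup>2)"
  shows "integrable M (\<lambda>\<omega>. (norm (exponential_integrator S k W u0 n \<omega>))\<^sup>2) \<and>
    prob_space.expectation M (\<lambda>\<omega>. (norm (exponential_integrator S k W u0 n \<omega>))\<^sup>2)
      = prob_space.expectation M (\<lambda>\<omega>. (norm (u0 \<omega>))\<^sup>2) + (real n * k) * op_trace Q"
proof (induction n)
  case 0
  then show ?case using int by simp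
next
  case (Suc n)
  note step = exponential_integrator_step_mass[OF P F S W u0 k Q Suc.IH[THEN conjunct1]]
  show ?case
    using step Suc.IH by (simp add: algebra_simps del: exponential_integrator.simps)
qed

theorem proposition3p4:
  fixes M :: "'w measure" and F :: "real \<Rightarrow> 'w measure"
    and S :: "real \<Rightarrow> (real ^ 'd) L2 \<Rightarrow> (real ^ 'd) L2"
    and Q :: "(real ^ 'd) L2 \<Rightarrow> (real ^ 'd) L2"
    and W :: "real \<Rightarrow> 'w \<Rightarrow> (real ^ 'd) L2"
    and u0 :: "'w \<Rightarrow> (real ^ 'd) L2"
    and u :: "nat \<Rightarrow> 'w \<Rightarrow> (real ^ 'd) L2"
    and k :: real and n :: nat
  assumes "prob_space M"
    and "normal_filtration M F"
    and "schroedinger_group S"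
    and "nonneg_selfadjoint Q"
    and "Q_wiener_process M F Q W"
    and "u0 \<in> borel_measurable (F 0)"
    and "k > 0"
    and "u = exponential_integrator S k W u0"
    and "integrable M (\<lambda>\<omega>. mass (u0 \<omega>))"
    and "trace_class Q"
    and "n \<ge> 1"
  shows "integrable M (\<lambda>\<omega>. mass (u n \<omega>)) \<and>
    prob_space.expectation M (\<lambda>\<omega>. mass (u n \<omega>))
      = prob_space.expectation M (\<lambda>\<omega>. mass (u (n - 1) \<omega>)) + k * op_trace Q \<and>
    prob_space.expectation M (\<lambda>\<omega>. mass (u n \<omega>))
      = prob_space.expectation M (\<lambda>\<omega>. mass (u0 \<omega>)) + (real n * k) * op_trace Q"
proof -
  have S: "unitary_group S" using assms(3) by (simp add: schroedinger_group_def)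
  have int: "integrable M (\<lambda>\<omega>. (norm (u0 \<omega>))\<^sup>2)" using assms(9) by (simp only: mass_eq_norm_square)
  note mass = exponential_integrator_mass[OF assms(1,2) S assms(5-7,10) int, folded assms(8)]
  obtain m where n: "n = Suc m" using assms(11) by (cases n) auto
  have "n - 1 = m" using n by simp
  then show ?thesis
    using exponential_integrator_step_mass(2)[OF assms(1,2) S assms(5-7,10), of m, folded assms(8)]
      mass[of m] mass[of n]
    unfolding mass_eq_norm_square n by (simp del: of_nat_Suc)
qed

end
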